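(* Let $G$ be a connected graph of order $n\ge 2$ with $V(G)=\{u_1,\ldots,u_n\}$ having no two distinct vertices $x,y$ with $N(x)=N(y)$, and let $\mathcal{H}=\{H_1,\ldots,H_n\}$ be a family of graphs each of diameter $D(H_i)\ge 6$. Then for any $k\in\{1,\ldots,\min\{\mathcal{T}(G\circ\mathcal{H}),\mathcal{C}(\mathcal{H})\}\}$, $\dim_k(G\circ\mathcal{H})=\sum_{i=1}^n\operatorname{adim}_k(H_i)$. Moreover, if $G$ is a connected graph of order $n\ge 2$ having no two distinct vertices $x,y$ with $N[x]=N[y]$, then (for the same range of $k$) $\dim_k(G\circ\overline{\mathcal{H}})=\sum_{i=1}^n\operatorname{adim}_k(H_i)$, where $\overline{\mathcal{H}}=\{\overline{H}_1,\ldots,\overline{H}_n\}$.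
   Context: Graphs are finite and simple; $\delta,\Delta$ minimum/maximum degree. Lexicographic product $G\circ\mathcal{F}$ for a family $\mathcal{F}=\{F_1,\dots,F_n\}$: vertex set $\bigcup_i\{u_i\}\times V(F_i)$, $(u_i,v)\sim(u_j,w)$ iff $u_iu_j\in E(G)$, or $i=j$ and $vw\in E(F_i)$. For connected $X$, $\dim_k(X)$ is the minimum size of $S\subseteq V(X)$ such that every two distinct vertices $x,y$ admit at least $k$ vertices $w\in S$ with $d_X(x,w)\neq d_X(y,w)$. For a graph $H$, $S$ is a $k$-adjacency generator if every two distinct $x,y$ satisfy $|((N_H(x)\triangledown N_H(y))\cup\{x,y\})\cap S|\ge k$; $\operatorname{adim}_k(H)$ is its minimum cardinality. $\mathcal{C}(H)=\min_{x\neq y}|(N_H(x)\triangledown N_H(y))\cup\{x,y\}|$, $\mathcal{C}(\mathcal{H})=\min_i\mathcal{C}(H_i)$. Distinct $x,y\in V(G)$ are true twins if $N[x]=N[y]$, false twins if $N(x)=N(y)$; the relation $N(x)-\{y\}=N(y)-\{x\}$ partitions $V(G)$ into singleton, false twin and true twin classes with unions $S(G),FT(G),TT(G)$; $FT(u_i),TT(u_i)$ is the class of $u_i$. $\mathcal{T}(u_i,\mathcal{H})=|V(H_i)|$ if $u_i\in S(G)$; $=\min\{\delta(H_j)+\delta(H_l)+2: u_j,u_l\in FT(u_i), j\neq l\}$ if $u_i\in FT(G)$; $=\min\{|V(H_j)|-\Delta(H_j)+|V(H_l)|-\Delta(H_l): u_j,u_l\in TT(u_i), j\neq l\}$ if $u_i\in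 TT(G)$; $\mathcal{T}(G\circ\mathcal{H})=\min_{u_i}\mathcal{T}(u_i,\mathcal{H})$. *)

theory Defs
  imports "Graph_Theory.Graph_Theory" "HOL-Library.Extended_Nat"
begin

text \<open>
  A finite simple graph is a \<^locale>\<open>pair_graph\<close>: every undirected edge is represented by
  its two arcs, so the degree of a vertex is its \<^const>\<open>out_degree\<close>.
\<close>

definition nbrs :: "'a pair_pre_digraph \<Rightarrow> 'a \<Rightarrow> 'a set" where
  "nbrs G x = {y. (x, y) \<in> parcs G}"

definition closed_nbrs :: "'a pair_pre_digraph \<Rightarrow> 'a \<Rightarrow> 'a set" where
  "closed_nbrs G x = insert x (nbrs G x)"

definition min_degree :: "'a pair_pre_digraph \<Rightarrow> nat" where
  "min_degree G = Min (out_degree G ` pverts G)"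

definition max_degree :: "'a pair_pre_digraph \<Rightarrow> nat" where
  "max_degree G = Max (out_degree G ` pverts G)"

text \<open>The length of a shortest path, \<open>\<infinity>\<close> if there is none.\<close>

definition gdist :: "'a pair_pre_digraph \<Rightarrow> 'a \<Rightarrow> 'a \<Rightarrow> ereal" where
  "gdist G x y = wf_digraph.\<mu> G (\<lambda>_. 1) x y"

definition gdiameter :: "'a pair_pre_digraph \<Rightarrow> ereal" where
  "gdiameter G = (SUP x\<in>pverts G. SUP y\<in>pverts G. gdist G x y)"

definition complement_graph :: "'a pair_pre_digraph \<Rightarrow> 'a pair_pre_digraph" where
  "complement_graph G = \<lparr> pverts = pverts G,
     parcs = {(x, y). x \<in> pverts G \<and> y \<in> pverts G \<and> x \<noteq> y \<and> (x, y) \<notin> parcs G} \<rparr>"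

text \<open>
  The family of second factors is indexed by the vertices of the first factor; only its
  members at vertices of the first factor matter.
\<close>

definition lex_product ::
  "'a pair_pre_digraph \<Rightarrow> ('a \<Rightarrow> 'b pair_pre_digraph) \<Rightarrow> ('a \<times> 'b) pair_pre_digraph" where
  "lex_product G F = \<lparr> pverts = (SIGMA u:pverts G. pverts (F u)),
     parcs = {((u, v), (u', w)). u \<in> pverts G \<and> v \<in> pverts (F u) \<and>
        u' \<in> pverts G \<and> w \<in> pverts (F u') \<and>
        ((u, u') \<in> parcs G \<or> u = u' \<and> (v, w) \<in> parcs (F u))} \<rparr>"

definition k_metric_generator :: "nat \<Rightarrow> 'a pair_pre_digraph \<Rightarrow> 'a set \<Rightarrow> bool" where
  "k_metric_generator k X S \<longleftrightarrow> S \<subseteq> pverts X \<and>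
     (\<forall>x\<in>pverts X. \<forall>y\<in>pverts X. x \<noteq> y \<longrightarrow> k \<le> card {w \<in> S. gdist X x w \<noteq> gdist X y w})"

text \<open>
  The minimum cardinality of a generator; in \<^typ>\<open>enat\<close> it is \<open>\<infinity>\<close> exactly if there is
  no generator, so that an equation with a finite number also asserts existence.
\<close>

definition kdim :: "nat \<Rightarrow> 'a pair_pre_digraph \<Rightarrow> enat" where
  "kdim k X = (INF S\<in>{S. k_metric_generator k X S}. enat (card S))"

definition adj_distinguishers :: "'a pair_pre_digraph \<Rightarrow> 'a \<Rightarrow> 'a \<Rightarrow> 'a set" where
  "adj_distinguishers H x y = sym_diff (nbrs H x) (nbrs H y) \<union> {x, y}"

definition k_adjacency_generator :: "nat \<Rightarrow> 'a pair_pre_digraph \<Rightarrow> 'a set \<Rightarrow> bool" where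
  "k_adjacency_generator k H S \<longleftrightarrow> S \<subseteq> pverts H \<and>
     (\<forall>x\<in>pverts H. \<forall>y\<in>pverts H. x \<noteq> y \<longrightarrow> k \<le> card (adj_distinguishers H x y \<inter> S))"

definition kadim :: "nat \<Rightarrow> 'a pair_pre_digraph \<Rightarrow> enat" where
  "kadim k H = (INF S\<in>{S. k_adjacency_generator k H S}. enat (card S))"

definition adj_const :: "'a pair_pre_digraph \<Rightarrow> nat" where
  "adj_const H =
     Min {card (adj_distinguishers H x y) |x y. x \<in> pverts H \<and> y \<in> pverts H \<and> x \<noteq> y}"

definition adj_const_family ::
  "'a pair_pre_digraph \<Rightarrow> ('a \<Rightarrow> 'b pair_pre_digraph) \<Rightarrow> nat" where
  "adj_const_family G H = Min ((\<lambda>u. adj_const (H u)) ` pverts G)"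

definition true_twins :: "'a pair_pre_digraph \<Rightarrow> 'a \<Rightarrow> 'a \<Rightarrow> bool" where
  "true_twins G x y \<longleftrightarrow> x \<in> pverts G \<and> y \<in> pverts G \<and> x \<noteq> y \<and> closed_nbrs G x = closed_nbrs G y"

definition false_twins :: "'a pair_pre_digraph \<Rightarrow> 'a \<Rightarrow> 'a \<Rightarrow> bool" where
  "false_twins G x y \<longleftrightarrow> x \<in> pverts G \<and> y \<in> pverts G \<and> x \<noteq> y \<and> nbrs G x = nbrs G y"

definition twin_class :: "'a pair_pre_digraph \<Rightarrow> 'a \<Rightarrow> 'a set" where
  "twin_class G u = {v \<in> pverts G. nbrs G u - {v} = nbrs G v - {u}}"

definition singleton_verts :: "'a pair_pre_digraph \<Rightarrow> 'a set" where
  "singleton_verts G = {u \<in> pverts G. twin_class G u = {u}}"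

definition false_twin_verts :: "'a pair_pre_digraph \<Rightarrow> 'a set" where
  "false_twin_verts G = {u \<in> pverts G. \<exists>v. false_twins G u v}"

text \<open>
  Every vertex is a singleton, a false twin or a true twin vertex, and only one of these; the
  final branch below is therefore the one for true twin vertices.
\<close>

definition twin_bound_at ::
  "'a pair_pre_digraph \<Rightarrow> ('a \<Rightarrow> 'b pair_pre_digraph) \<Rightarrow> 'a \<Rightarrow> nat" where
  "twin_bound_at G H u =
    (if u \<in> singleton_verts G then card (pverts (H u))
     else if u \<in> false_twin_verts G then
       Min {min_degree (H v) + min_degree (H w) + 2 |v w.
         v \<in> twin_class G u \<and> w \<in> twin_class G u \<and> v \<noteq> w}
     else
       Min {(card (pverts (H v)) - max_degree (H v)) + (card (pverts (H w)) - max_degree (H w)) |v w.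
         v \<in> twin_class G u \<and> w \<in> twin_class G u \<and> v \<noteq> w})"

definition twin_bound ::
  "'a pair_pre_digraph \<Rightarrow> ('a \<Rightarrow> 'b pair_pre_digraph) \<Rightarrow> nat" where
  "twin_bound G H = Min (twin_bound_at G H ` pverts G)"

lemma pair_graph_iff:
  "pair_graph G \<longleftrightarrow> finite (pverts G) \<and> parcs G \<subseteq> pverts G \<times> pverts G \<and>
     sym (parcs G) \<and> irrefl (parcs G)"
proof
  assume "pair_graph G"
  then interpret pair_graph G .
  show "finite (pverts G) \<and> parcs G \<subseteq> pverts G \<times> pverts G \<and> sym (parcs G) \<and> irrefl (parcs G)"
    using pair_finite_verts arcs_symmetric
    by (auto simp: irrefl_def sym_def dest: in_arcsD1 in_arcsD2 no_loops')
next
  assume *: "finite (pverts G) \<and> parcs G \<subseteq> pverts G \<times> pverts G \<and> sym (parcs G) \<and> irrefl (parcs G)"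
  then have "finite (parcs G)"
    by (blast intro: finite_subset)
  with * show "pair_graph G"
    by unfold_locales (auto simp: symmetric_def irrefl_def)
qed

lemma pair_graph_complement: "pair_graph G \<Longrightarrow> pair_graph (complement_graph G)"
  by (auto simp: pair_graph_iff complement_graph_def sym_def irrefl_def)

lemma pair_graph_lex_product:
  assumes "pair_graph G" and "\<And>u. u \<in> pverts G \<Longrightarrow> pair_graph (F u)"
  shows "pair_graph (lex_product G F)"
  using assms unfolding pair_graph_iff lex_product_def
  by (auto simp: irrefl_def intro!: symI dest: symD)

end

theory Submission
  imports Defs
begin

text \<open>
  In a lexicographic product over a base without isolated vertices, vertices of different fibres
  are as far apart as their projections, and distances inside a fibre are capped at 2.  So two
  vertices of one fibre are distinguished exactly by their adjacency distinguishers in that fibre,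
  which gives the lower bound.  For the upper bound take the union of optimal adjacency generators:
  over non-twins \<open>u, u'\<close> the whole fibre over a vertex adjacent to only one of them
  distinguishes, and over twins the generator \<open>S\<close> of one fibre needs \<open>k\<close> elements outside
  \<open>N(v)\<close>, for each \<open>v\<close> (true twins, fibre \<open>H u\<close>; false twins, complementary fibre).  If the
  diameter is at least 6, there are two vertices whose distinguishers all avoid \<open>N(v)\<close>, so \<open>S\<close>
  has \<open>k\<close> such elements.
\<close>

section \<open>Walks and distances\<close>

lemma awalk_iff_relpow:
  assumes "pair_graph G" and "x \<in> pverts G"
  shows "(\<exists>p. pre_digraph.awalk G x p y \<and> length p = n) \<longleftrightarrow> (x, y) \<in> parcs G ^^ n"
proof -
  interpret pair_graph G by fact
  show ?thesis
    using assms(2)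
  proof (induction n arbitrary: x)
    case 0
    then show ?case by (auto simp: awalk_Nil_iff)
  next
    case (Suc n)
    have "(\<exists>p. awalk x p y \<and> length p = Suc n) \<longleftrightarrow>
        (\<exists>z. (x, z) \<in> parcs G \<and> (\<exists>p. awalk z p y \<and> length p = n))"
    proof
      assume "\<exists>p. awalk x p y \<and> length p = Suc n"
      then obtain e p where "awalk x (e # p) y" "length p = n"
        by (auto simp: length_Suc_conv)
      then show "\<exists>z. (x, z) \<in> parcs G \<and> (\<exists>p. awalk z p y \<and> length p = n)"
        by (metis awalk_Cons_iff prod.collapse)
    next
      assume "\<exists>z. (x, z) \<in> parcs G \<and> (\<exists>p. awalk z p y \<and> length p = n)"
      then obtain z p where "(x, z) \<in> parcs G" "awalk z p y" "length p = n"
        by blast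
      then show "\<exists>p. awalk x p y \<and> length p = Suc n"
        by (intro exI[of _ "(x, z) # p"]) (simp add: awalk_Cons_iff)
    qed
    also have "\<dots> \<longleftrightarrow> (\<exists>z. (x, z) \<in> parcs G \<and> (z, y) \<in> parcs G ^^ n)"
      using Suc.IH in_arcsD2 by blast
    also have "\<dots> \<longleftrightarrow> (x, y) \<in> parcs G ^^ Suc n"
      by (meson relpow_Suc_I2 relpow_Suc_D2)
    finally show ?case .
  qed
qed

text \<open>Unit costs make the cost of a walk its length. Relation powers keep only that length,
  which suits the projection and lifting of walks in a product; without a walk the infimum is
  infinite.\<close>

lemma gdist_relpow:
  assumes "pair_graph G" and "x \<in> pverts G"
  shows "gdist G x y = (INF n\<in>{n. (x, y) \<in> parcs G ^^ n}. ereal (real n))"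
proof -
  interpret pair_graph G by fact
  have cost: "awalk_cost (\<lambda>_. 1) p = real (length p)" for p :: "('a \<times> 'a) list"
    by (induction p) auto
  have "{n. (x, y) \<in> parcs G ^^ n} = length ` {p. awalk x p y}"
    using awalk_iff_relpow[OF assms] by (auto simp: image_iff) metis+
  then show ?thesis
    by (simp add: gdist_def \<mu>_def cost image_image)
qed

lemma gdist_le:
  assumes "pair_graph G" and "x \<in> pverts G" and "(x, y) \<in> parcs G ^^ n"
  shows "gdist G x y \<le> real n"
  using assms by (auto simp: gdist_relpow intro: INF_lower2)

lemma gdist_eq:
  assumes "pair_graph G" and "x \<in> pverts G" and "(x, y) \<in> parcs G ^^ n"
    and "\<And>m. m < n \<Longrightarrow> (x, y) \<notin> parcs G ^^ m"
  shows "gdist G x y = real n"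
  unfolding gdist_relpow[OF assms(1,2)]
proof (rule antisym)
  show "(INF n\<in>{n. (x, y) \<in> parcs G ^^ n}. ereal (real n)) \<le> real n"
    using assms(3) by (auto intro: INF_lower2)
  show "ereal (real n) \<le> (INF n\<in>{n. (x, y) \<in> parcs G ^^ n}. ereal (real n))"
    using assms(4) by (intro INF_greatest) (auto simp: not_less[symmetric])
qed

lemma gdist_self: "pair_graph G \<Longrightarrow> x \<in> pverts G \<Longrightarrow> gdist G x x = 0"
  using gdist_eq[of G x x 0] by (simp add: zero_ereal_def)

lemma gdist_adjacent:
  assumes "pair_graph G" and "(x, y) \<in> parcs G"
  shows "gdist G x y = 1"
proof -
  have "x \<in> pverts G" "x \<noteq> y"
    using assms by (auto simp: pair_graph_iff irrefl_def)
  then show ?thesis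
    using gdist_eq[of G x y 1] assms by (simp add: one_ereal_def)
qed

lemma gdist_common_neighbour:
  assumes "pair_graph G" and "(x, z) \<in> parcs G" and "(z, y) \<in> parcs G"
    and "x \<noteq> y" and "(x, y) \<notin> parcs G"
  shows "gdist G x y = 2"
proof -
  have "(x, y) \<in> parcs G ^^ 2"
    using assms by (auto simp: numeral_2_eq_2)
  moreover have "(x, y) \<notin> parcs G ^^ m" if "m < 2" for m
    using that assms by (auto simp: less_2_cases_iff)
  moreover have "x \<in> pverts G"
    using assms by (auto simp: pair_graph_iff)
  ultimately show ?thesis
    using gdist_eq[of G x y 2] assms by simp
qed

lemma connected_neighbour:
  assumes "pair_graph G" and "connected G" and "x \<in> pverts G" and "y \<in> pverts G" and "x \<noteq> y"
  obtains z where "(x, z) \<in> parcs G"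
proof -
  interpret pair_graph G by fact
  \<comment> \<open>\<open>connected\<close> refers to the symmetrised digraph; the arcs of
    \<open>G\<close> are symmetric already, so directed walks exist.\<close>
  have "strongly_connected G"
    using symmetric_connected_imp_strongly_connected[OF sym_arcs assms(2)] .
  then obtain p where "awalk x p y"
    using assms(3,4) by (auto simp: strongly_connected_def reachable_awalk)
  with \<open>x \<noteq> y\<close> show ?thesis
    using that by (cases p) (auto simp: awalk_Nil_iff awalk_Cons_iff)
qed

section \<open>Consequences of a large diameter\<close>

lemma card_at_least_2_other:
  assumes "2 \<le> card A"
  obtains y where "y \<in> A" and "y \<noteq> x"
proof -
  have "\<not> A \<subseteq> {x}"
    using assms card_mono[of "{x}" A] by auto
  then show ?thesis
    using that by auto
qed

text \<open>Call a vertex far if it is neither in N(v) nor adjacent to a member of N(v); any two far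
  vertices will do. Two vertices that are not far are joined through \<open>v\<close> by a walk of
  length at most 4. Diameter 6 gives \<open>a\<close>, \<open>b\<close> with all walks longer than
  5, so at least one of them is far. If only one is, its neighbours are far too, for otherwise some
  walk from \<open>a\<close> to \<open>b\<close> would have length at most 5.\<close>

lemma far_pair:
  assumes H: "pair_graph H" "connected H" and diam: "gdiameter H \<ge> 6"
  obtains x y where "x \<in> pverts H" "y \<in> pverts H" "x \<noteq> y"
    "adj_distinguishers H x y \<inter> nbrs H v = {}"
proof -
  let ?R = "parcs H"
  define far where "far x \<longleftrightarrow> (\<forall>p. (v, p) \<in> ?R \<longrightarrow> p \<noteq> x \<and> (x, p) \<notin> ?R)" for x
  have sym: "(q, p) \<in> ?R" if "(p, q) \<in> ?R" for p q
    using H that by (auto simp: pair_graph_iff dest: symD)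
  \<comment> \<open>Being strictly below the supremum, 5 is exceeded by the distance of an actual
    pair.\<close>
  have "5 < gdiameter H"
    using diam by (rule less_le_trans[rotated]) simp
  then obtain a b where ab: "a \<in> pverts H" "b \<in> pverts H" "5 < gdist H a b"
    by (auto simp: gdiameter_def less_SUP_iff)
  have long: "5 < n" if "(a, b) \<in> ?R ^^ n" for n
  proof -
    have "5 < ereal (real n)"
      using ab(3) gdist_le[OF H(1) ab(1) that] by (rule less_le_trans)
    then show ?thesis
      by simp
  qed
  \<comment> \<open>The walk passes through a neighbour of \<open>v\<close>. Both directions are
    recorded so that two such walks can be joined at \<open>v\<close>.\<close>
  have near: "\<exists>i\<le>2. (x, v) \<in> ?R ^^ i \<and> (v, x) \<in> ?R ^^ i" if "\<not> far x" for x
  proof -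
    from that obtain p where p: "(v, p) \<in> ?R" "p = x \<or> (x, p) \<in> ?R"
      by (auto simp: far_def)
    show ?thesis
    proof (cases "p = x")
      case True
      with p(1) sym[OF p(1)] show ?thesis
        by (intro exI[of _ 1]) simp
    next
      case False
      with p have "(x, p) \<in> ?R" "(p, x) \<in> ?R"
        using sym by blast+
      then have "(x, v) \<in> ?R ^^ 2" "(v, x) \<in> ?R ^^ 2"
        using p(1) sym[OF p(1)] by (auto simp: numeral_2_eq_2)
      then show ?thesis
        by blast
    qed
  qed
  have near_near: "\<exists>n\<le>4. (x, y) \<in> ?R ^^ n" if far: "\<not> far x" "\<not> far y" for x y
  proof -
    obtain i j where "i \<le> 2" "j \<le> 2" "(x, v) \<in> ?R ^^ i" "(v, y) \<in> ?R ^^ j"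
      using near[OF far(1)] near[OF far(2)] by blast
    then have "(x, y) \<in> ?R ^^ (i + j)" "i + j \<le> 4"
      by (simp add: relpow_add relcompI, simp)
    then show ?thesis
      by blast
  qed
  \<comment> \<open>A neighbour of \<open>v\<close> is neither \<open>x\<close> nor
    \<open>y\<close>, and adjacent to neither.\<close>
  have disj: "adj_distinguishers H x y \<inter> nbrs H v = {}" if "far x" "far y" for x y
    using that by (auto simp: far_def adj_distinguishers_def nbrs_def)
  have "a \<noteq> b"
    by (rule notI) (use long[of 0] in simp)
  have "\<exists>x\<in>pverts H. \<exists>y\<in>pverts H. x \<noteq> y \<and> far x \<and> far y"
  proof (cases "far a"; cases "far b")
    assume "far a" "far b"
    then show ?thesis
      using ab \<open>a \<noteq> b\<close> by blast
  next
    assume "far a" "\<not> far b"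
    obtain y where y: "(a, y) \<in> ?R"
      using connected_neighbour[OF H ab(1,2) \<open>a \<noteq> b\<close>] .
    have "far y"
    proof (rule ccontr)
      assume "\<not> far y"
      then obtain n where "n \<le> 4" "(y, b) \<in> ?R ^^ n"
        using near_near \<open>\<not> far b\<close> by blast
      then show False
        using long[OF relpow_Suc_I2[OF y]] by fastforce
    qed
    moreover have "y \<in> pverts H" "a \<noteq> y"
      using H y by (auto simp: pair_graph_iff irrefl_def)
    ultimately show ?thesis
      using ab \<open>far a\<close> by blast
  next
    assume "\<not> far a" "far b"
    obtain y where y: "(b, y) \<in> ?R"
      using connected_neighbour[OF H ab(2,1)] \<open>a \<noteq> b\<close> by metis
    have "far y"
    proof (rule ccontr)
      assume "\<not> far y"
      then obtain n where "n \<le> 4" "(a, y) \<in> ?R ^^ n"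
        using near_near \<open>\<not> far a\<close> by blast
      then show False
        using long[OF relpow_Suc_I[OF _ sym[OF y]]] by fastforce
    qed
    moreover have "y \<in> pverts H" "b \<noteq> y"
      using H y by (auto simp: pair_graph_iff irrefl_def)
    ultimately show ?thesis
      using ab \<open>far b\<close> by blast
  next
    assume "\<not> far a" "\<not> far b"
    then obtain n where "n \<le> 4" "(a, b) \<in> ?R ^^ n"
      using near_near by blast
    then show ?thesis
      using long by fastforce
  qed
  then show ?thesis
    using that disj by blast
qed

lemma card_generator_outside_nbrs:
  assumes "pair_graph H" and "connected H" and "gdiameter H \<ge> 6"
    and gen: "k_adjacency_generator k H S"
  shows "k \<le> card (S - nbrs H v)"
proof -
  obtain x y where xy: "x \<in> pverts H" "y \<in> pverts H" "x \<noteq> y"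
    "adj_distinguishers H x y \<inter> nbrs H v = {}"
    using far_pair[OF assms(1-3)] .
  have "finite S"
    using gen assms(1) finite_subset by (auto simp: k_adjacency_generator_def pair_graph_iff)
  have "k \<le> card (adj_distinguishers H x y \<inter> S)"
    using gen xy by (auto simp: k_adjacency_generator_def)
  also have "\<dots> \<le> card (S - nbrs H v)"
    using xy(4) \<open>finite S\<close> by (intro card_mono) auto
  finally show ?thesis .
qed

text \<open>The pair from \<open>far_pair\<close>, for any \<open>v\<close>, has two distinct
  members. This supplies the assumption \<open>card_fibre\<close> of
  \<open>lex_family\<close>.\<close>

lemma diameter_card_verts:
  assumes "pair_graph H" and "connected H" and "gdiameter H \<ge> 6"
  shows "2 \<le> card (pverts H)"
proof -
  obtain x y where "x \<in> pverts H" "y \<in> pverts H" "x \<noteq> y"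
    using far_pair[OF assms] by metis
  then show ?thesis
    using card_mono[of "pverts H" "{x, y}"] assms(1) by (auto simp: pair_graph_iff)
qed

section \<open>Adjacency generators: complements and minima\<close>

lemma nbrs_complement:
  assumes "x \<in> pverts H"
  shows "nbrs (complement_graph H) x = pverts H - closed_nbrs H x"
  using assms by (auto simp: nbrs_def complement_graph_def closed_nbrs_def)

text \<open>For a vertex other than \<open>x\<close> and \<open>y\<close>, complementing flips its
  adjacency to both, so whether it is adjacent to exactly one is unchanged; \<open>x\<close> and
  \<open>y\<close> belong to the set in any case.\<close>

lemma adj_distinguishers_complement:
  assumes "pair_graph H" and "x \<in> pverts H" and "y \<in> pverts H"
  shows "adj_distinguishers (complement_graph H) x y = adj_distinguishers H x y"
  using assms
  by (auto simp: adj_distinguishers_def nbrs_def complement_graph_def pair_graph_iff)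

lemma k_adjacency_generator_complement:
  assumes "pair_graph H"
  shows "k_adjacency_generator k (complement_graph H) S \<longleftrightarrow> k_adjacency_generator k H S"
  using assms adj_distinguishers_complement[OF assms]
  by (auto simp: k_adjacency_generator_def complement_graph_def)

lemma kadim_complement: "pair_graph H \<Longrightarrow> kadim k (complement_graph H) = kadim k H"
  by (simp add: kadim_def k_adjacency_generator_complement)

text \<open>A finite value rules out the infimum of the empty set, and a nonempty set in
  \<open>enat\<close> contains its infimum.\<close>

lemma kadim_attained:
  assumes "kadim k H \<noteq> \<infinity>"
  obtains S where "k_adjacency_generator k H S" and "kadim k H = enat (card S)"
proof -
  let ?A = "(\<lambda>S. enat (card S)) ` {S. k_adjacency_generator k H S}"
  have "?A \<noteq> {}"
    using assms by (auto simp: kadim_def Inf_enat_def split: if_splits)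
  then have "Inf ?A \<in> ?A"
    unfolding Inf_enat_def by (auto intro: LeastI)
  then show ?thesis
    using that by (auto simp: kadim_def)
qed

section \<open>Distances in lexicographic products\<close>

text \<open>The common ground of the products over \<open>H\<close> and over the complements. A
  neighbour of each base vertex caps distances inside a fibre at 2; two vertices in each fibre force
  its adjacency generators to have at least \<open>k\<close> elements.\<close>

locale lex_family =
  fixes G :: "'a pair_pre_digraph" and F :: "'a \<Rightarrow> 'b pair_pre_digraph"
  assumes pair_graph_base: "pair_graph G"
    and non_isolated: "u \<in> pverts G \<Longrightarrow> nbrs G u \<noteq> {}"
    and pair_graph_fibre: "u \<in> pverts G \<Longrightarrow> pair_graph (F u)"
    and card_fibre: "u \<in> pverts G \<Longrightarrow> 2 \<le> card (pverts (F u))"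
begin

abbreviation X where "X \<equiv> lex_product G F"

lemma pair_graph_X: "pair_graph X"
  using pair_graph_lex_product pair_graph_base pair_graph_fibre by blast

lemma finite_verts: "finite (pverts G)"
  using pair_graph_base by (simp add: pair_graph_iff)

lemma fibre_nonempty: "u \<in> pverts G \<Longrightarrow> \<exists>v. v \<in> pverts (F u)"
  using card_at_least_2_other[OF card_fibre] by blast

lemma arc_verts: "(u, z) \<in> parcs G \<Longrightarrow> u \<in> pverts G \<and> z \<in> pverts G"
  using pair_graph_base by (auto simp: pair_graph_iff)

lemma arc_sym: "(u, z) \<in> parcs G \<Longrightarrow> (z, u) \<in> parcs G"
  using pair_graph_base by (auto simp: pair_graph_iff dest: symD)

lemma verts_X: "(u, v) \<in> pverts X \<longleftrightarrow> u \<in> pverts G \<and> v \<in> pverts (F u)"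
  by (simp add: lex_product_def)

lemma arcs_X:
  "((u, v), (z, w)) \<in> parcs X \<longleftrightarrow> u \<in> pverts G \<and> v \<in> pverts (F u) \<and> z \<in> pverts G \<and>
     w \<in> pverts (F z) \<and> ((u, z) \<in> parcs G \<or> u = z \<and> (v, w) \<in> parcs (F u))"
  by (simp add: lex_product_def)

text \<open>A step inside a fibre projects to standing still, so the projected walk may be
  shorter.\<close>

lemma relpow_project:
  assumes "(p, q) \<in> parcs X ^^ n"
  shows "\<exists>m\<le>n. (fst p, fst q) \<in> parcs G ^^ m"
  using assms
proof (induction n arbitrary: q)
  case 0
  then show ?case by auto
next
  case (Suc n)
  then obtain r where r: "(p, r) \<in> parcs X ^^ n" "(r, q) \<in> parcs X"
    by auto
  then obtain m where m: "m \<le> n" "(fst p, fst r) \<in> parcs G ^^ m"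
    using Suc.IH by blast
  have "(fst r, fst q) \<in> parcs G \<or> fst r = fst q"
    using r(2) arcs_X by (metis prod.collapse)
  then show ?case
  proof
    assume "(fst r, fst q) \<in> parcs G"
    with m show ?thesis
      by (intro exI[of _ "Suc m"]) auto
  next
    assume "fst r = fst q"
    with m show ?thesis
      by (intro exI[of _ m]) auto
  qed
qed

text \<open>The inner vertices of the walk can be chosen freely in their nonempty fibres, and the
  last arc reaches every vertex over \<open>z\<close>. The length must be positive, since the empty
  walk lifts only to \<open>v = w\<close>.\<close>

lemma relpow_lift:
  assumes "(u, z) \<in> parcs G ^^ Suc n" and "v \<in> pverts (F u)" and "w \<in> pverts (F z)"
  shows "((u, v), (z, w)) \<in> parcs X ^^ Suc n"
  using assms
proof (induction n arbitrary: z w)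
  case 0
  then show ?case
    using arc_verts by (auto simp: arcs_X)
next
  case (Suc n)
  from Suc.prems(1) obtain y where y: "(u, y) \<in> parcs G ^^ Suc n" "(y, z) \<in> parcs G"
    by (rule relpow_Suc_E)
  then obtain x where x: "x \<in> pverts (F y)"
    using fibre_nonempty arc_verts by blast
  have "((u, v), (y, x)) \<in> parcs X ^^ Suc n"
    using Suc.IH y(1) Suc.prems(2) x .
  moreover have "((y, x), (z, w)) \<in> parcs X"
    using y(2) x Suc.prems(3) arc_verts by (auto simp: arcs_X)
  ultimately show ?case
    by (rule relpow_Suc_I)
qed

text \<open>A base walk lifts to one of equal length, and a product walk projects to one that is no
  longer. Distinct projections exclude the empty walk, so lifting applies.\<close>

lemma gdist_distinct_fibres:
  assumes "(u, v) \<in> pverts X" and "(z, w) \<in> pverts X" and "u \<noteq> z"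
  shows "gdist X (u, v) (z, w) = gdist G u z"
proof -
  have u: "u \<in> pverts G"
    using assms by (simp add: verts_X)
  show ?thesis
    unfolding gdist_relpow[OF pair_graph_X assms(1)] gdist_relpow[OF pair_graph_base u]
  proof (intro antisym INF_mono)
    fix n assume "n \<in> {n. (u, z) \<in> parcs G ^^ n}"
    then have n: "(u, z) \<in> parcs G ^^ n"
      by simp
    with \<open>u \<noteq> z\<close> obtain m where m: "n = Suc m"
      by (cases n) auto
    have "((u, v), (z, w)) \<in> parcs X ^^ n"
      using relpow_lift[OF n[unfolded m]] assms(1,2) by (simp only: verts_X m)
    then show "\<exists>m\<in>{n. ((u, v), (z, w)) \<in> parcs X ^^ n}. ereal (real m) \<le> ereal (real n)"
      by blast
  next
    fix n assume "n \<in> {n. ((u, v), (z, w)) \<in> parcs X ^^ n}"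
    then have "((u, v), (z, w)) \<in> parcs X ^^ n"
      by simp
    then obtain m where "m \<le> n" "(u, z) \<in> parcs G ^^ m"
      using relpow_project by fastforce
    then show "\<exists>m\<in>{n. (u, z) \<in> parcs G ^^ n}. ereal (real m) \<le> ereal (real n)"
      by (intro bexI[of _ m]) simp_all
  qed
qed

text \<open>Every vertex over a neighbour of \<open>u\<close> is adjacent to the whole fibre over
  \<open>u\<close>, so two non-adjacent vertices of that fibre are at distance 2, however far apart
  they are in \<open>F u\<close>.\<close>

lemma gdist_same_fibre:
  assumes "(u, v) \<in> pverts X" and "(u, w) \<in> pverts X"
  shows "gdist X (u, v) (u, w) = (if v = w then 0 else if w \<in> nbrs (F u) v then 1 else 2)"
proof -
  have u: "u \<in> pverts G" "v \<in> pverts (F u)" "w \<in> pverts (F u)"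
    using assms by (simp_all only: verts_X)
  consider "v = w" | "v \<noteq> w" "(v, w) \<in> parcs (F u)" | "v \<noteq> w" "(v, w) \<notin> parcs (F u)"
    by blast
  then show ?thesis
  proof cases
    case 1
    then show ?thesis
      using gdist_self[OF pair_graph_X assms(1)] by simp
  next
    case 2
    then have "((u, v), (u, w)) \<in> parcs X"
      using u by (simp add: arcs_X)
    with 2 show ?thesis
      using gdist_adjacent[OF pair_graph_X] by (simp add: nbrs_def)
  next
    case 3
    obtain z where z: "(u, z) \<in> parcs G"
      using non_isolated[OF u(1)] by (auto simp: nbrs_def)
    then obtain x where "x \<in> pverts (F z)"
      using fibre_nonempty arc_verts by blast
    then have "((u, v), (z, x)) \<in> parcs X" "((z, x), (u, w)) \<in> parcs X"
      using u z arc_verts[OF z] arc_sym[OF z] by (simp_all add: arcs_X)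
    \<comment> \<open>There is no loop at \<open>u\<close>, so arcs inside the fibre come from
      \<open>F u\<close> alone.\<close>
    moreover have "((u, v), (u, w)) \<notin> parcs X"
      using 3 pair_graph_base by (auto simp: arcs_X pair_graph_iff irrefl_def)
    ultimately show ?thesis
      using gdist_common_neighbour[OF pair_graph_X] 3 by (auto simp: nbrs_def)
  qed
qed

text \<open>Another fibre sees \<open>v\<close> and \<open>v'\<close> at the same distance. Inside
  the fibre the distances 0, 1, 2 mean equal, adjacent and neither, so they differ at
  \<open>v\<close>, at \<open>v'\<close> and where exactly one of the two is adjacent.\<close>

lemma distinguished_same_fibre_iff:
  assumes "(u, v) \<in> pverts X" and "(u, v') \<in> pverts X" and "v \<noteq> v'" and "(z, w) \<in> pverts X"
  shows "gdist X (u, v) (z, w) \<noteq> gdist X (u, v') (z, w) \<longleftrightarrow>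
    z = u \<and> w \<in> adj_distinguishers (F u) v v'"
proof (cases "z = u")
  case True
  have "x \<notin> nbrs (F u) x" for x
    using pair_graph_fibre[of u] assms(1) by (auto simp: verts_X pair_graph_iff irrefl_def nbrs_def)
  with True assms show ?thesis
    by (auto simp: gdist_same_fibre adj_distinguishers_def)
next
  case False
  with assms show ?thesis
    by (simp add: gdist_distinct_fibres)
qed

section \<open>The lower bound\<close>

lemma generator_fibre:
  assumes "k_metric_generator k X S" and "u \<in> pverts G"
  shows "k_adjacency_generator k (F u) {w. (u, w) \<in> S}"
  unfolding k_adjacency_generator_def
proof (intro conjI ballI impI)
  have S: "S \<subseteq> pverts X"
    using assms by (simp add: k_metric_generator_def)
  then show "{w. (u, w) \<in> S} \<subseteq> pverts (F u)"
    by (auto simp: lex_product_def)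
  fix v v' assume v: "v \<in> pverts (F u)" "v' \<in> pverts (F u)" "v \<noteq> v'"
  then have vX: "(u, v) \<in> pverts X" "(u, v') \<in> pverts X"
    using assms(2) by (auto simp: verts_X)
  have "k \<le> card {q \<in> S. gdist X (u, v) q \<noteq> gdist X (u, v') q}"
    using assms(1) v vX by (simp add: k_metric_generator_def)
  \<comment> \<open>Members of \<open>S\<close> over other base vertices do not distinguish, so the
    count takes place in the slice over \<open>u\<close>.\<close>
  also have "{q \<in> S. gdist X (u, v) q \<noteq> gdist X (u, v') q} =
      Pair u ` (adj_distinguishers (F u) v v' \<inter> {w. (u, w) \<in> S})"
    using distinguished_same_fibre_iff[OF vX v(3)] S by auto
  also have "card \<dots> = card (adj_distinguishers (F u) v v' \<inter> {w. (u, w) \<in> S})"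
    by (simp add: card_image inj_on_def)
  finally show "k \<le> card (adj_distinguishers (F u) v v' \<inter> {w. (u, w) \<in> S})" .
qed

lemma enat_card_Sigma:
  assumes "\<And>u. u \<in> pverts G \<Longrightarrow> S u \<subseteq> pverts (F u)"
  shows "enat (card (SIGMA u:pverts G. S u)) = (\<Sum>u\<in>pverts G. enat (card (S u)))"
proof -
  have "finite (S u)" if "u \<in> pverts G" for u
    using assms[OF that] pair_graph_fibre[OF that] finite_subset by (auto simp: pair_graph_iff)
  then have "card (SIGMA u:pverts G. S u) = (\<Sum>u\<in>pverts G. card (S u))"
    using finite_verts by simp
  then show ?thesis
    by (simp add: of_nat_eq_enat[symmetric])
qed

text \<open>The slices of \<open>S\<close> are disjoint and exhaust it, and each is an adjacency
  generator of its fibre.\<close>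

lemma sum_kadim_le_kdim: "(\<Sum>u\<in>pverts G. kadim k (F u)) \<le> kdim k X"
  unfolding kdim_def
proof (rule INF_greatest)
  fix S assume "S \<in> {S. k_metric_generator k X S}"
  then have S: "k_metric_generator k X S"
    by simp
  let ?S = "\<lambda>u. {w. (u, w) \<in> S}"
  have "S = (SIGMA u:pverts G. ?S u)"
    using S by (auto simp: k_metric_generator_def lex_product_def)
  then have "enat (card S) = (\<Sum>u\<in>pverts G. enat (card (?S u)))"
    using enat_card_Sigma[of ?S] generator_fibre[OF S] by (simp add: k_adjacency_generator_def)
  moreover have "kadim k (F u) \<le> enat (card (?S u))" if "u \<in> pverts G" for u
    unfolding kadim_def using generator_fibre[OF S that] by (auto intro: INF_lower2)
  ultimately show "(\<Sum>u\<in>pverts G. kadim k (F u)) \<le> enat (card S)"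
    by (simp add: sum_mono)
qed

section \<open>The upper bound\<close>

lemma card_generator_fibre:
  assumes "k_adjacency_generator k (F u) S" and "u \<in> pverts G"
  shows "k \<le> card S"
proof -
  have F: "finite (pverts (F u))" "2 \<le> card (pverts (F u))"
    using assms pair_graph_fibre card_fibre by (auto simp: pair_graph_iff)
  then obtain x where x: "x \<in> pverts (F u)"
    using assms(2) fibre_nonempty by blast
  obtain y where y: "y \<in> pverts (F u)" "y \<noteq> x"
    using card_at_least_2_other[OF F(2)] .
  have "finite S"
    using assms(1) F(1) finite_subset by (auto simp: k_adjacency_generator_def)
  have "k \<le> card (adj_distinguishers (F u) x y \<inter> S)"
    using assms(1) x y by (auto simp: k_adjacency_generator_def)
  also have "\<dots> \<le> card S"
    using \<open>finite S\<close> by (intro card_mono) auto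
  finally show ?thesis .
qed

lemma gdist_non_twins:
  assumes "(u, v) \<in> pverts X" and "(u', v') \<in> pverts X" and "(z, w) \<in> pverts X"
    and "z \<noteq> u" and "z \<noteq> u'" and "(u, z) \<in> parcs G" and "(u', z) \<notin> parcs G"
  shows "gdist X (u, v) (z, w) \<noteq> gdist X (u', v') (z, w)"
proof -
  have "gdist G u z = 1"
    using gdist_adjacent[OF pair_graph_base assms(6)] .
  moreover have "gdist G u' z \<noteq> 1"
  proof
    assume "gdist G u' z = 1"
    \<comment> \<open>A distance below 2 comes from a walk of length 0 or 1, excluded by
      \<open>z \<noteq> u'\<close> and by non-adjacency.\<close>
    then have "(INF n\<in>{n. (u', z) \<in> parcs G ^^ n}. ereal (real n)) < ereal 2"
      using gdist_relpow[OF pair_graph_base, of u' z] assms(2) by (simp add: verts_X)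
    then obtain n where "(u', z) \<in> parcs G ^^ n" "n < 2"
      by (auto simp: INF_less_iff)
    then show False
      using assms(5,7) by (auto simp: less_2_cases_iff)
  qed
  ultimately show ?thesis
    using assms by (simp add: gdist_distinct_fibres)
qed

text \<open>The assumption covers the one case that the generators do not settle by themselves:
  twins \<open>u\<close>, \<open>u'\<close> of the base. From all of the fibre over
  \<open>u\<close>, a vertex over \<open>u'\<close> is at the same distance, 1 for adjacent twins
  and 2 otherwise. \<open>(u, v)\<close> is at distance 1 exactly from its neighbours in the fibre,
  and below 2 exactly from its closed neighbourhood there; this gives the two sets in the
  assumption.\<close>

theorem kdim_lex_product:
  assumes twins: "\<And>u u' v S. u \<in> pverts G \<Longrightarrow> u' \<in> pverts G \<Longrightarrow> u \<noteq> u' \<Longrightarrow>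
      nbrs G u - {u'} = nbrs G u' - {u} \<Longrightarrow> v \<in> pverts (F u) \<Longrightarrow>
      k_adjacency_generator k (F u) S \<Longrightarrow>
      k \<le> card (if (u, u') \<in> parcs G then S - nbrs (F u) v else S \<inter> closed_nbrs (F u) v)"
  shows "kdim k X = (\<Sum>u\<in>pverts G. kadim k (F u))"
proof (rule antisym[OF _ sum_kadim_le_kdim])
  show "kdim k X \<le> (\<Sum>u\<in>pverts G. kadim k (F u))"
  proof (cases "\<exists>u\<in>pverts G. kadim k (F u) = \<infinity>")
    case True
    then obtain u where u: "u \<in> pverts G" "kadim k (F u) = \<infinity>"
      by blast
    \<comment> \<open>A fibre without a generator makes the sum infinite.\<close>
    have "kadim k (F u) \<le> (\<Sum>u\<in>pverts G. kadim k (F u))"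
      using u finite_verts by (intro member_le_sum) auto
    with u show ?thesis
      by simp
  next
    case False
    then have "\<forall>u\<in>pverts G. \<exists>S. k_adjacency_generator k (F u) S \<and> kadim k (F u) = enat (card S)"
      using kadim_attained by metis
    then obtain S where gen: "\<And>u. u \<in> pverts G \<Longrightarrow> k_adjacency_generator k (F u) (S u)"
      and dim: "\<And>u. u \<in> pverts G \<Longrightarrow> kadim k (F u) = enat (card (S u))"
      by metis
    have S: "S u \<subseteq> pverts (F u)" if "u \<in> pverts G" for u
      using gen[OF that] by (simp add: k_adjacency_generator_def)
    let ?T = "SIGMA u:pverts G. S u"
    have T: "?T \<subseteq> pverts X"
      using S by (auto simp: lex_product_def)
    then have finT: "finite ?T"
      using pair_graph_X finite_subset by (auto simp: pair_graph_iff)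
    \<comment> \<open>Each case below finds its \<open>k\<close> distinguishing members of
      \<open>?T\<close> within one fibre, over \<open>z\<close>.\<close>
    have many: "k \<le> card {q \<in> ?T. gdist X p q \<noteq> gdist X p' q}"
      if "z \<in> pverts G" "k \<le> card A" "A \<subseteq> S z"
        "\<And>w. w \<in> A \<Longrightarrow> gdist X p (z, w) \<noteq> gdist X p' (z, w)" for p p' z A
    proof -
      have "card (Pair z ` A) \<le> card {q \<in> ?T. gdist X p q \<noteq> gdist X p' q}"
        using that finT by (intro card_mono) auto
      then show ?thesis
        using that(2) by (simp add: card_image inj_on_def)
    qed
    have "k_metric_generator k X ?T"
      unfolding k_metric_generator_def
    proof (intro conjI ballI impI)
      show "?T \<subseteq> pverts X" by fact
      fix p p' assume p: "p \<in> pverts X" "p' \<in> pverts X" "p \<noteq> p'"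
      obtain u v u' v' where eq: "p = (u, v)" "p' = (u', v')"
        by (metis prod.collapse)
      have u: "u \<in> pverts G" "v \<in> pverts (F u)" "u' \<in> pverts G" "v' \<in> pverts (F u')"
        using p by (auto simp: eq verts_X)
      show "k \<le> card {q \<in> ?T. gdist X p q \<noteq> gdist X p' q}"
      proof (cases "u = u'")
        case True
        have "k \<le> card (adj_distinguishers (F u) v v' \<inter> S u)"
          using gen[OF u(1)] u p True by (auto simp: eq k_adjacency_generator_def)
        moreover have "gdist X p (u, w) \<noteq> gdist X p' (u, w)"
          if "w \<in> adj_distinguishers (F u) v v' \<inter> S u" for w
          using distinguished_same_fibre_iff[of u v v' u w] p that S[OF u(1)] u(1) True
          by (auto simp: eq verts_X)
        ultimately show ?thesis
          using many[OF u(1)] by blast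
      next
        case False
        show ?thesis
        proof (cases "nbrs G u - {u'} = nbrs G u' - {u}")
          case twin: True
          let ?A = "if (u, u') \<in> parcs G then S u - nbrs (F u) v else S u \<inter> closed_nbrs (F u) v"
          have "k \<le> card ?A"
            using twins[OF u(1,3) False twin u(2) gen[OF u(1)]] .
          moreover have "?A \<subseteq> S u"
            by auto
          moreover have "gdist X p (u, w) \<noteq> gdist X p' (u, w)" if w: "w \<in> ?A" for w
          proof -
            have wX: "(u, w) \<in> pverts X"
              using w S[OF u(1)] u(1) by (auto simp: verts_X split: if_splits)
            have p': "gdist X p' (u, w) = gdist G u' u"
              using gdist_distinct_fibres[of u' v' u w] p wX False by (simp add: eq)
            show ?thesis
            proof (cases "(u, u') \<in> parcs G")
              case True
              then have "gdist G u' u = 1"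
                using gdist_adjacent[OF pair_graph_base] arc_sym by blast
              with True w p p' wX show ?thesis
                by (auto simp: eq gdist_same_fibre)
            next
              case nonadj: False
              \<comment> \<open>Non-adjacent twins have equal neighbourhoods, so any neighbour of
                \<open>u\<close> is a common one and puts \<open>u'\<close> at distance 2.\<close>
              obtain z where z: "(u, z) \<in> parcs G"
                using non_isolated[OF u(1)] by (auto simp: nbrs_def)
              then have "z \<in> nbrs G u'"
                using twin nonadj by (auto simp: nbrs_def)
              then have "gdist G u' u = 2"
                using arc_sym[OF z] arc_sym[of u' u] nonadj False
                by (intro gdist_common_neighbour[OF pair_graph_base, of u' z]) (auto simp: nbrs_def)
              with nonadj w p p' wX show ?thesis
                by (auto simp: eq gdist_same_fibre closed_nbrs_def)
            qed
          qed
          ultimately show ?thesis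
            using many[OF u(1)] by blast
        next
          case nontwin: False
          have loop: "(x, x) \<notin> parcs G" for x
            using pair_graph_base by (auto simp: pair_graph_iff irrefl_def)
          \<comment> \<open>\<open>z\<close> is adjacent to exactly one of \<open>u\<close>,
            \<open>u'\<close> and, for lack of loops, differs from both. Every vertex over
            \<open>z\<close> then distinguishes, so all of \<open>S z\<close> counts.\<close>
          from nontwin obtain z where "z \<in> nbrs G u - {u'} \<longleftrightarrow> z \<notin> nbrs G u' - {u}"
            by (auto simp: set_eq_iff)
          then have z: "z \<noteq> u" "z \<noteq> u'"
            "(u, z) \<in> parcs G \<and> (u', z) \<notin> parcs G \<or> (u, z) \<notin> parcs G \<and> (u', z) \<in> parcs G"
            using loop[of u] loop[of u'] by (auto simp: nbrs_def)
          then have zG: "z \<in> pverts G"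
            using arc_verts by blast
          have "gdist X p (z, w) \<noteq> gdist X p' (z, w)" if "w \<in> S z" for w
          proof -
            have wX: "(z, w) \<in> pverts X"
              using that S zG by (auto simp: verts_X)
            then show ?thesis
              using z(3) gdist_non_twins[OF p(1)[unfolded eq] p(2)[unfolded eq] wX z(1,2)]
                gdist_non_twins[OF p(2)[unfolded eq] p(1)[unfolded eq] wX z(2,1)]
              by (auto simp: eq)
          qed
          then show ?thesis
            using many[OF zG card_generator_fibre[OF gen[OF zG] zG]] by blast
        qed
      qed
    qed
    then have "kdim k X \<le> enat (card ?T)"
      unfolding kdim_def by (auto intro: INF_lower2)
    also have "\<dots> = (\<Sum>u\<in>pverts G. kadim k (F u))"
      using enat_card_Sigma[OF S] dim by simp
    finally show ?thesis .
  qed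
qed

end

section \<open>The products over the family and over its complements\<close>

theorem theorem22:
  fixes G :: "'a pair_pre_digraph" and H :: "'a \<Rightarrow> 'b pair_pre_digraph" and k :: nat
  assumes "pair_graph G" and "connected G" and "card (pverts G) \<ge> 2"
    and "\<And>u. u \<in> pverts G \<Longrightarrow> pair_graph (H u)"
    and "\<And>u. u \<in> pverts G \<Longrightarrow> connected (H u)"
    and "\<And>u. u \<in> pverts G \<Longrightarrow> gdiameter (H u) \<ge> 6"
    and "k \<in> {1..min (twin_bound G H) (adj_const_family G H)}"
  shows "((\<nexists>x y. false_twins G x y) \<longrightarrow>
            kdim k (lex_product G H) = (\<Sum>u\<in>pverts G. kadim k (H u))) \<and>
         ((\<nexists>x y. true_twins G x y) \<longrightarrow>
            kdim k (lex_product G (\<lambda>u. complement_graph (H u))) = (\<Sum>u\<in>pverts G. kadim k (H u)))"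
proof -
  have non_isolated: "nbrs G u \<noteq> {}" if u: "u \<in> pverts G" for u
  proof -
    obtain y where y: "y \<in> pverts G" "y \<noteq> u"
      using card_at_least_2_other[OF assms(3)] .
    obtain z where "(u, z) \<in> parcs G"
      using connected_neighbour[OF assms(1,2) u y(1) y(2)[symmetric]] .
    then show ?thesis
      by (auto simp: nbrs_def)
  qed
  have sym: "(x, y) \<in> parcs G \<longleftrightarrow> (y, x) \<in> parcs G" for x y
    using assms(1) by (auto simp: pair_graph_iff dest: symD)
  \<comment> \<open>This bound, always for \<open>H u\<close> itself, serves both products.\<close>
  note outside = card_generator_outside_nbrs[OF assms(4,5,6)]
  interpret H: lex_family G H
    by (rule lex_family.intro)
      (use assms(1,4) non_isolated diameter_card_verts[OF assms(4,5,6)] in blast)+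
  interpret H': lex_family G "\<lambda>u. complement_graph (H u)"
  proof (rule lex_family.intro)
    show "2 \<le> card (pverts (complement_graph (H u)))" if "u \<in> pverts G" for u
      using diameter_card_verts[OF assms(4,5,6)] that by (simp add: complement_graph_def)
  qed (use assms(1,4) non_isolated pair_graph_complement in blast)+
  show ?thesis
  proof (intro conjI impI)
    assume no_twins: "\<nexists>x y. false_twins G x y"
    show "kdim k (lex_product G H) = (\<Sum>u\<in>pverts G. kadim k (H u))"
    proof (rule H.kdim_lex_product)
      fix u u' v S
      assume u: "u \<in> pverts G" "u' \<in> pverts G" "u \<noteq> u'"
        and twin: "nbrs G u - {u'} = nbrs G u' - {u}"
        and S: "k_adjacency_generator k (H u) S"
      \<comment> \<open>Non-adjacent twins would be false twins, so only the branch for adjacent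
        ones remains.\<close>
      have "(u, u') \<in> parcs G"
      proof (rule ccontr)
        assume "(u, u') \<notin> parcs G"
        then have "nbrs G u = nbrs G u'"
          using twin sym by (auto simp: nbrs_def set_eq_iff)
        with u no_twins show False
          by (auto simp: false_twins_def)
      qed
      then show "k \<le> card (if (u, u') \<in> parcs G then S - nbrs (H u) v
          else S \<inter> closed_nbrs (H u) v)"
        using outside[OF u(1) u(1) u(1) S] by simp
    qed
  next
    assume no_twins: "\<nexists>x y. true_twins G x y"
    have "kdim k (lex_product G (\<lambda>u. complement_graph (H u))) =
        (\<Sum>u\<in>pverts G. kadim k (complement_graph (H u)))"
    proof (rule H'.kdim_lex_product)
      fix u u' v S
      assume u: "u \<in> pverts G" "u' \<in> pverts G" "u \<noteq> u'"
        and twin: "nbrs G u - {u'} = nbrs G u' - {u}"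
        and v: "v \<in> pverts (complement_graph (H u))"
        and S: "k_adjacency_generator k (complement_graph (H u)) S"
      \<comment> \<open>Adjacent twins would be true twins, so only the branch with closed
        neighbourhoods remains.\<close>
      have "(u, u') \<notin> parcs G"
      proof
        assume "(u, u') \<in> parcs G"
        then have "closed_nbrs G u = closed_nbrs G u'"
          using twin sym[of u u'] by (auto simp: closed_nbrs_def nbrs_def set_eq_iff)
        with u no_twins show False
          by (auto simp: true_twins_def)
      qed
      moreover have S': "k_adjacency_generator k (H u) S"
        using S k_adjacency_generator_complement[OF assms(4)[OF u(1)]] by simp
      \<comment> \<open>The closed neighbourhood of \<open>v\<close> in the complement consists of
        all vertices that are not neighbours of \<open>v\<close> in \<open>H u\<close>, which leads
        back to \<open>outside\<close>.\<close>
      moreover have "S \<inter> closed_nbrs (complement_graph (H u)) v = S - nbrs (H u) v"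
      proof -
        have "v \<in> pverts (H u)"
          using v by (simp add: complement_graph_def)
        moreover have "v \<notin> nbrs (H u) v"
          using assms(4)[OF u(1)] by (auto simp: nbrs_def pair_graph_iff irrefl_def)
        ultimately show ?thesis
          using S' by (auto simp: closed_nbrs_def nbrs_complement k_adjacency_generator_def)
      qed
      ultimately show "k \<le> card (if (u, u') \<in> parcs G then S - nbrs (complement_graph (H u)) v
          else S \<inter> closed_nbrs (complement_graph (H u)) v)"
        using outside[OF u(1) u(1) u(1) S'] by simp
    qed
    \<comment> \<open>Complementing a fibre keeps its adjacency generators, hence their least
      size.\<close>
    then show "kdim k (lex_product G (\<lambda>u. complement_graph (H u))) =
        (\<Sum>u\<in>pverts G. kadim k (H u))"
      using kadim_complement[OF assms(4)] by simp
  qed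
qed

end
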